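(* If $G$ is a randomly $3$-dimensional graph, then $G=K_4$.
   Context: All graphs are finite, simple and connected. For vertices $x,y$, $d(x,y)$ is the distance in $G$. For an ordered set $W=\{w_1,\dots,w_k\}\subseteq V(G)$ and $v\in V(G)$, $r(v|W)=(d(v,w_1),\dots,d(v,w_k))$. $W$ is a resolving set if distinct vertices have distinct representations with respect to $W$; a basis is a minimum-size resolving set and its size is the metric dimension $\beta(G)$. $G$ is randomly $k$-dimensional if $\beta(G)=k$ and every $k$-subset of $V(G)$ is a basis of $G$. *)

theory Defs
  imports "Graph_Theory.Graph_Theory"
begin

text \<open>
  A finite simple undirected graph is a \<^const>\<open>graph\<close> of the library: a finite symmetric digraph
  without loops and without parallel arcs.
\<close>

definition gdist :: "('a, 'b) pre_digraph \<Rightarrow> 'a \<Rightarrow> 'a \<Rightarrow> ereal" where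
  "gdist G u v = wf_digraph.\<mu> G (\<lambda>_. 1) u v"

definition metric_rep :: "('a, 'b) pre_digraph \<Rightarrow> 'a \<Rightarrow> 'a list \<Rightarrow> ereal list" where
  "metric_rep G v ws = map (gdist G v) ws"

text \<open>
  An ordered set is a distinct list. Whether the representations are pairwise distinct does not
  depend on the chosen order, see \<open>resolving_set_any_order\<close>.
\<close>

definition resolving_set :: "('a, 'b) pre_digraph \<Rightarrow> 'a set \<Rightarrow> bool" where
  "resolving_set G W \<longleftrightarrow> W \<subseteq> verts G \<and>
     (\<exists>ws. distinct ws \<and> set ws = W \<and> inj_on (\<lambda>v. metric_rep G v ws) (verts G))"

lemma resolving_set_any_order:
  assumes "distinct ws" and "set ws = W"
  shows "resolving_set G W \<longleftrightarrow> W \<subseteq> verts G \<and> inj_on (\<lambda>v. metric_rep G v ws) (verts G)"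
proof -
  have "inj_on (\<lambda>v. metric_rep G v us) (verts G)"
    if "set us = set vs" "inj_on (\<lambda>v. metric_rep G v vs) (verts G)" for us vs
    using that by (auto simp: inj_on_def metric_rep_def)
  then show ?thesis
    using assms unfolding resolving_set_def by metis
qed

definition metric_basis :: "('a, 'b) pre_digraph \<Rightarrow> 'a set \<Rightarrow> bool" where
  "metric_basis G W \<longleftrightarrow> is_arg_min card (resolving_set G) W"

definition metric_dimension :: "('a, 'b) pre_digraph \<Rightarrow> nat" where
  "metric_dimension G = Min (card ` {W. resolving_set G W})"

definition randomly_dimensional :: "nat \<Rightarrow> ('a, 'b) pre_digraph \<Rightarrow> bool" where
  "randomly_dimensional k G \<longleftrightarrow> metric_dimension G = k \<and>
     (\<forall>W. W \<subseteq> verts G \<and> card W = k \<longrightarrow> metric_basis G W)"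

end

theory Submission
  imports Defs
begin

text \<open>
  For a pair \<open>{u, v}\<close> of vertices let \<open>E u v\<close> be the set of vertices equidistant from \<open>u\<close> and \<open>v\<close>. All
  triples resolve, so \<open>E u v\<close> has at most two elements; no pair resolves, so every pair lies in some
  \<open>E u v\<close>. Hence \<open>E\<close> is a bijection of the set of pairs onto itself. Counting the pairs whose image
  contains \<open>w\<close> gives, for the sizes \<open>s i\<close> of the distance levels of \<open>w\<close>, the balance
  \<open>(\<Sum>i\<ge>1. s i choose 2) = (\<Sum>i\<ge>1. s i) = n - 1\<close>.

  A neighbour \<open>a\<close> of \<open>w\<close> splits each level into at most three classes, and only one pair may be
  equidistant from both \<open>w\<close> and \<open>a\<close>; hence all levels have size at most 4, with at most one of size 4.
  Leaves are impossible since a leaf and its neighbour have no equidistant vertex, and degree 4 forces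
  the level sizes 4, 1, 1, hence a leaf. Not all degrees are 2, since then all levels have size at
  most 2 and the balance fails. At a vertex of degree 3 all levels have size 3, so \<open>n\<close> is 1 modulo 3,
  which by the balance excludes degree 2. So the graph is cubic, and each vertex \<open>w\<close> has at most three
  further vertices that are equidistant from two of its neighbours. If \<open>w\<close> has maximal eccentricity
  \<open>D \<ge> 2\<close>, these include the three vertices at distance \<open>D\<close> and one of the neighbours of \<open>w\<close>, a
  contradiction. So the diameter is 1.
\<close>

section \<open>Unordered pairs, pigeonhole and small binomial coefficients\<close>

definition pairs :: "'a set \<Rightarrow> 'a set set" where
  "pairs A = {p. p \<subseteq> A \<and> card p = 2}"

lemma finite_pairs: "finite A \<Longrightarrow> finite (pairs A)"
  unfolding pairs_def by (rule finite_subset[of _ "Pow A"]) auto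

lemma card_pairs: "finite A \<Longrightarrow> card (pairs A) = card A choose 2"
  unfolding pairs_def by (rule n_subsets)

lemma pairsE:
  assumes "p \<in> pairs A"
  obtains x y where "p = {x, y}" "x \<noteq> y" "x \<in> A" "y \<in> A"
  using assms unfolding pairs_def card_2_iff by auto

lemma pairsI: "x \<in> A \<Longrightarrow> y \<in> A \<Longrightarrow> x \<noteq> y \<Longrightarrow> {x, y} \<in> pairs A"
  unfolding pairs_def by auto

lemma pairs_mono: "A \<subseteq> B \<Longrightarrow> pairs A \<subseteq> pairs B"
  unfolding pairs_def by auto

lemma pigeonhole_pair:
  assumes "f ` A \<subseteq> B" "finite B" "card B < card A"
  shows "\<exists>p\<in>pairs A. \<forall>x\<in>p. \<forall>y\<in>p. f x = f y"
proof -
  have "\<not> inj_on f A"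
    using assms by (metis card_image card_mono not_less)
  then obtain x y where "x \<in> A" "y \<in> A" "x \<noteq> y" "f x = f y"
    unfolding inj_on_def by auto
  then show ?thesis
    by (intro bexI[of _ "{x, y}"]) (auto intro: pairsI)
qed

lemma card_le_3: "card {a, b, c} \<le> 3"
  by (simp add: card_insert_if)

lemma choose_2_le: "n \<le> 3 \<Longrightarrow> n choose 2 \<le> n"
  by (auto simp: numeral_eq_Suc le_Suc_eq)

text \<open>In this range the deficit \<open>n - (n choose 2)\<close> vanishes exactly at 0 and 3.
  It is compared level by level when \<open>sum_card_level\<close> meets
  \<open>sum_level_choose_2\<close>.\<close>

lemma choose_2_less: "n \<le> 3 \<Longrightarrow> n \<notin> {0, 3} \<Longrightarrow> n choose 2 = n - 1"
  by (auto simp: numeral_eq_Suc le_Suc_eq)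

section \<open>Distance functions of connected graphs: levels and equidistant vertices\<close>

text \<open>Adjacency is distance 1. The assumption \<open>d_step\<close> replaces paths: it
  provides the last but one vertex of a shortest path.\<close>

locale graph_metric =
  fixes V :: "'a set" and d :: "'a \<Rightarrow> 'a \<Rightarrow> nat"
  assumes finite_V: "finite V"
    and V_nonempty: "V \<noteq> {}"
    and d_eq_0: "\<And>u v. u \<in> V \<Longrightarrow> v \<in> V \<Longrightarrow> d u v = 0 \<longleftrightarrow> u = v"
    and d_sym: "\<And>u v. u \<in> V \<Longrightarrow> v \<in> V \<Longrightarrow> d u v = d v u"
    and d_triangle: "\<And>u v w. u \<in> V \<Longrightarrow> v \<in> V \<Longrightarrow> w \<in> V \<Longrightarrow> d u w \<le> d u v + d v w"
    and d_step: "\<And>u v m. u \<in> V \<Longrightarrow> v \<in> V \<Longrightarrow> d u v = Suc m \<Longrightarrow> \<exists>x\<in>V. d u x = m \<and> d x v = 1"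
begin

definition level :: "'a \<Rightarrow> nat \<Rightarrow> 'a set" where
  "level w i = {x \<in> V. d w x = i}"

text \<open>A bound common to all vertices, so that sums over levels have the same range for every
  \<open>w\<close>. Levels beyond the eccentricity of \<open>w\<close> are empty, which is why size
  0 stays among the cases below.\<close>

definition diam :: nat where
  "diam = Max ((\<lambda>(u, v). d u v) ` (V \<times> V))"

text \<open>Takes a set rather than two vertices, so that it can map \<open>pairs V\<close> to
  itself.\<close>

definition equidistant :: "'a set \<Rightarrow> 'a set" where
  "equidistant p = {w \<in> V. \<forall>x\<in>p. \<forall>y\<in>p. d w x = d w y}"

lemma finite_level: "finite (level w i)"
  unfolding level_def using finite_V by simp

lemma level_subset: "level w i \<subseteq> V"
  unfolding level_def by auto

lemma equidistant_subset: "equidistant p \<subseteq> V"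
  unfolding equidistant_def by auto

lemma finite_equidistant: "finite (equidistant p)"
  using equidistant_subset finite_V finite_subset by blast

lemma level_0: "w \<in> V \<Longrightarrow> level w 0 = {w}"
  using d_eq_0 by (auto simp: level_def)

lemma neq_of_level_1: "w \<in> V \<Longrightarrow> a \<in> level w 1 \<Longrightarrow> w \<noteq> a"
  using d_eq_0[of w a] by (auto simp: level_def)

lemma d_le_diam: "u \<in> V \<Longrightarrow> v \<in> V \<Longrightarrow> d u v \<le> diam"
  unfolding diam_def using finite_V by (intro Max_ge) auto

lemma diam_attained: "\<exists>u\<in>V. \<exists>v\<in>V. d u v = diam"
proof -
  have "diam \<in> (\<lambda>(u, v). d u v) ` (V \<times> V)"
    unfolding diam_def using finite_V V_nonempty by (intro Max_in) auto
  then show ?thesis by (auto split: prod.splits) blast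
qed

lemma sum_card_level:
  assumes "w \<in> V"
  shows "(\<Sum>i=1..diam. card (level w i)) = card V - 1"
proof -
  have "V - {w} = (\<Union>i\<in>{1..diam}. level w i)"
  proof (intro set_eqI iffI)
    fix x assume "x \<in> V - {w}"
    then have "x \<in> level w (d w x)" "d w x \<in> {1..diam}"
      using assms d_le_diam[of w x] d_eq_0[of w x] by (auto simp: level_def Suc_le_eq)
    then show "x \<in> (\<Union>i\<in>{1..diam}. level w i)" by blast
  next
    fix x assume "x \<in> (\<Union>i\<in>{1..diam}. level w i)"
    then show "x \<in> V - {w}" using assms d_eq_0[of w x] by (auto simp: level_def)
  qed
  then have "card (V - {w}) = (\<Sum>i=1..diam. card (level w i))"
    using finite_level by (simp only:) (subst card_UN_disjoint, auto simp: level_def)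
  then show ?thesis using assms finite_V by simp
qed

lemma d_neighbour_cases:
  assumes "w \<in> V" "a \<in> V" "x \<in> V" "d w a = 1"
  shows "d x a \<in> {d x w - 1, d x w, d x w + 1}"
  using d_triangle[of x w a] d_triangle[of x a w] assms d_sym[of w a] by auto

lemma d_neighbours_le_2:
  assumes "w \<in> V" "a \<in> level w 1" "b \<in> level w 1"
  shows "d a b \<le> 2"
  using d_triangle[of a w b] assms d_sym[of w a] by (auto simp: level_def)

text \<open>Distances to the neighbour \<open>a\<close> take at most three values on a level, so two
  of four vertices collide; their distances to \<open>w\<close> agree anyway.\<close>

lemma level_pair:
  assumes "w \<in> V" "a \<in> level w 1" "A \<subseteq> level w i" "card A \<ge> 4"
  shows "\<exists>p\<in>pairs A. {w, a} \<subseteq> equidistant p"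
proof -
  have "\<exists>p\<in>pairs A. \<forall>x\<in>p. \<forall>y\<in>p. d a x = d a y"
  proof (rule pigeonhole_pair)
    show "d a ` A \<subseteq> {i - 1, i, i + 1}"
    proof
      fix k assume "k \<in> d a ` A"
      then obtain x where x: "x \<in> A" "k = d a x" by blast
      then have "x \<in> V" "d w x = i" "a \<in> V" "d w a = 1" using assms by (auto simp: level_def)
      then show "k \<in> {i - 1, i, i + 1}"
        using d_neighbour_cases[of w a x] assms(1) x(2) d_sym[of a x] d_sym[of x w] by simp
    qed
    show "card {i - 1, i, i + 1} < card A"
      using card_le_3[of "i - 1" i "i + 1"] assms(4) by linarith
  qed simp
  then obtain p where p: "p \<in> pairs A" "\<forall>x\<in>p. \<forall>y\<in>p. d a x = d a y" by blast
  then have "p \<subseteq> level w i" using assms(3) by (auto simp: pairs_def)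
  then have "\<forall>x\<in>p. d w x = i" by (auto simp: level_def)
  then have "w \<in> equidistant p" using assms(1) by (simp add: equidistant_def)
  moreover have "a \<in> equidistant p"
    using p(2) assms(2) unfolding equidistant_def level_def by blast
  ultimately show ?thesis using p(1) by auto
qed

lemma d_neighbours:
  assumes "w \<in> V" "x \<in> level w 1" "y \<in> level w 1" "x \<noteq> y"
  shows "d x y \<in> {1, 2}"
  using d_neighbours_le_2[OF assms(1-3)] assms(4) d_eq_0[of x y] assms(2,3) level_subset[of w 1]
  by (cases "d x y") auto

text \<open>Distances between neighbours of \<open>w\<close> are 1 or 2, so two of the three agree,
  and the two pairs concerned share a vertex \<open>x\<close>.\<close>

lemma triple_equidistant:
  assumes "w \<in> V" "card (level w 1) = 3"
  obtains x p where "p \<in> pairs (level w 1)" "x \<in> level w 1" "x \<in> equidistant p"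
proof -
  obtain a b c where N: "level w 1 = {a, b, c}" "a \<noteq> b" "a \<noteq> c" "b \<noteq> c"
    using assms(2) unfolding card_3_iff by auto
  have V: "a \<in> V" "b \<in> V" "c \<in> V" using N(1) level_subset[of w 1] by auto
  have "d a b \<in> {1, 2}" "d a c \<in> {1, 2}" "d b c \<in> {1, 2}"
    using d_neighbours[OF assms(1)] N by simp_all
  then consider "d a b = d a c" | "d b a = d b c" | "d c a = d c b"
    using d_sym[of a b] d_sym[of a c] d_sym[of b c] V by auto
  then show ?thesis
  proof cases
    case 1
    then show ?thesis using that[of "{b, c}" a] N V by (simp add: equidistant_def pairsI)
  next
    case 2
    then show ?thesis using that[of "{a, c}" b] N V by (simp add: equidistant_def pairsI)
  next
    case 3
    then show ?thesis using that[of "{a, b}" c] N V by (simp add: equidistant_def pairsI)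
  qed
qed

text \<open>Only three distances from \<open>x\<close> are possible for the four neighbours of
  \<open>w\<close>. If \<open>x\<close> is one of them, the other three are at distance 1 or
  2.\<close>

lemma equidistant_from_neighbours:
  assumes w: "w \<in> V" and N: "card (level w 1) = 4" and x: "x \<in> V"
  shows "\<exists>p\<in>pairs (level w 1). x \<in> equidistant p"
proof -
  have "\<exists>p\<in>pairs (level w 1). \<forall>y\<in>p. \<forall>z\<in>p. d x y = d x z"
  proof (cases "x \<in> level w 1")
    case True
    have "\<exists>p\<in>pairs (level w 1 - {x}). \<forall>y\<in>p. \<forall>z\<in>p. d x y = d x z"
    proof (rule pigeonhole_pair)
      show "d x ` (level w 1 - {x}) \<subseteq> {1, 2}" using d_neighbours[OF w True] by blast
      show "card {1, 2 :: nat} < card (level w 1 - {x})" using N True finite_level[of w 1] by simp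
    qed simp
    then show ?thesis using pairs_mono[of "level w 1 - {x}" "level w 1"] by blast
  next
    case False
    show ?thesis
    proof (rule pigeonhole_pair)
      show "d x ` level w 1 \<subseteq> {d x w - 1, d x w, d x w + 1}"
        using d_neighbour_cases[OF w _ x] by (auto simp: level_def)
      show "card {d x w - 1, d x w, d x w + 1} < card (level w 1)"
        using N card_le_3[of "d x w - 1" "d x w" "d x w + 1"] by linarith
    qed simp
  qed
  then show ?thesis using x unfolding equidistant_def by blast
qed

lemma pairs_level_equidistant:
  assumes "w \<in> V" "p \<in> pairs (level w i)"
  shows "p \<in> pairs V" "w \<in> equidistant p"
  using assms pairs_mono[OF level_subset[of w i]]
  by blast (use assms in \<open>auto elim!: pairsE simp: equidistant_def level_def\<close>)

end

section \<open>The bijection on pairs and the balance of the levels\<close>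

locale randomly_3_dimensional = graph_metric +
  assumes card_V: "card V \<ge> 2"
    and card_equidistant_le: "\<And>u v. u \<in> V \<Longrightarrow> v \<in> V \<Longrightarrow> u \<noteq> v \<Longrightarrow> card (equidistant {u, v}) \<le> 2"
    and unresolved: "\<And>w x. w \<in> V \<Longrightarrow> x \<in> V \<Longrightarrow> w \<noteq> x \<Longrightarrow> \<exists>p\<in>pairs V. {w, x} \<subseteq> equidistant p"
begin

text \<open>A pair contained in the at most two-element set \<open>equidistant p\<close> equals it,
  so the image of \<open>equidistant\<close> contains \<open>pairs V\<close>. As it cannot have more
  elements than \<open>pairs V\<close>, the map is injective and the image is no larger.\<close>

lemma equidistant_bij: "bij_betw equidistant (pairs V) (pairs V)"
proof -
  have "q \<in> equidistant ` pairs V" if q: "q \<in> pairs V" for q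
  proof -
    obtain w x where wx: "q = {w, x}" "w \<noteq> x" "w \<in> V" "x \<in> V"
      using q by (rule pairsE)
    then obtain p where p: "p \<in> pairs V" "q \<subseteq> equidistant p" using unresolved by blast
    have "card (equidistant p) \<le> 2" using p(1) card_equidistant_le by (auto elim!: pairsE)
    moreover have "card q = 2" using wx by simp
    ultimately have "q = equidistant p"
      using p(2) finite_equidistant by (intro card_seteq) auto
    then show ?thesis using p(1) by blast
  qed
  then have sub: "pairs V \<subseteq> equidistant ` pairs V" by blast
  have fin: "finite (pairs V)" using finite_V by (rule finite_pairs)
  have "card (equidistant ` pairs V) = card (pairs V)"
    using card_mono[OF _ sub] card_image_le[OF fin, of equidistant] fin by simp
  then have "inj_on equidistant (pairs V)" "equidistant ` pairs V = pairs V"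
    using fin card_subset_eq[OF _ sub] by (auto intro: eq_card_imp_inj_on)
  then show ?thesis by (simp add: bij_betw_def)
qed

lemma card_equidistant: "p \<in> pairs V \<Longrightarrow> card (equidistant p) = 2"
  using bij_betwE[OF equidistant_bij] by (simp add: pairs_def)

text \<open>Both sets have size 2 and hence equal \<open>{w, x}\<close>, and
  \<open>equidistant\<close> is injective. Later arguments produce two pairs for the same
  \<open>w\<close> and \<open>x\<close> and derive a contradiction.\<close>

lemma pair_unique:
  assumes "p \<in> pairs V" "q \<in> pairs V" "{w, x} \<subseteq> equidistant p" "{w, x} \<subseteq> equidistant q" "w \<noteq> x"
  shows "p = q"
proof -
  have "{w, x} = equidistant r" if "r \<in> {p, q}" for r
    using that assms card_equidistant finite_equidistant by (intro card_seteq) auto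
  then have "equidistant p = equidistant q" by blast
  then show ?thesis using assms(1,2) equidistant_bij by (auto simp: bij_betw_def inj_on_def)
qed

lemma card_pairs_containing:
  assumes "w \<in> V"
  shows "card {q \<in> pairs V. w \<in> q} = card V - 1"
proof -
  have "{q \<in> pairs V. w \<in> q} = (\<lambda>x. {w, x}) ` (V - {w})"
    using assms by (auto elim!: pairsE intro: pairsI)
  moreover have "inj_on (\<lambda>x. {w, x}) (V - {w})"
    by (auto simp: inj_on_def doubleton_eq_iff)
  ultimately show ?thesis using assms finite_V by (simp add: card_image)
qed

text \<open>Double counting of the pairs \<open>p\<close> with \<open>w\<close> in
  \<open>equidistant p\<close>: the bijection sends them to the pairs containing \<open>w\<close>,
  and they are the pairs inside a level of \<open>w\<close>.\<close>

lemma sum_level_choose_2: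
  assumes "w \<in> V"
  shows "(\<Sum>i=1..diam. card (level w i) choose 2) = card V - 1"
proof -
  have "card {p \<in> pairs V. w \<in> equidistant p} = card {q \<in> pairs V. w \<in> q}"
  proof (rule bij_betw_same_card[of equidistant])
    have "equidistant ` {p \<in> pairs V. w \<in> equidistant p} = {q \<in> equidistant ` pairs V. w \<in> q}"
      by auto
    then show "bij_betw equidistant {p \<in> pairs V. w \<in> equidistant p} {q \<in> pairs V. w \<in> q}"
      using equidistant_bij by (auto simp: bij_betw_def intro: inj_on_subset)
  qed
  moreover have "{p \<in> pairs V. w \<in> equidistant p} = (\<Union>i\<in>{1..diam}. pairs (level w i))"
  proof (intro set_eqI iffI)
    fix p assume "p \<in> {p \<in> pairs V. w \<in> equidistant p}"
    then obtain x y where p: "p = {x, y}" "x \<noteq> y" "x \<in> V" "y \<in> V" "d w x = d w y"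
      by (auto elim!: pairsE simp: equidistant_def)
    then have "p \<in> pairs (level w (d w x))" by (auto intro!: pairsI simp: level_def)
    moreover have "d w x \<noteq> 0" using p d_eq_0[OF assms] by metis
    then have "d w x \<in> {1..diam}" using d_le_diam[of w x] assms p by simp
    ultimately show "p \<in> (\<Union>i\<in>{1..diam}. pairs (level w i))" by blast
  next
    fix p assume "p \<in> (\<Union>i\<in>{1..diam}. pairs (level w i))"
    then obtain i x y where p: "p = {x, y}" "x \<noteq> y" "x \<in> level w i" "y \<in> level w i"
      by (auto elim!: pairsE)
    then show "p \<in> {p \<in> pairs V. w \<in> equidistant p}"
      using assms by (auto simp: level_def equidistant_def intro!: pairsI)
  qed
  moreover have "card (\<Union>i\<in>{1..diam}. pairs (level w i)) = (\<Sum>i=1..diam. card (pairs (level w i)))"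
  proof (rule card_UN_disjoint)
    show "\<forall>i\<in>{1..diam}. \<forall>j\<in>{1..diam}. i \<noteq> j \<longrightarrow> pairs (level w i) \<inter> pairs (level w j) = {}"
      by (auto elim!: pairsE simp: level_def doubleton_eq_iff)
  qed (use finite_pairs finite_level in auto)
  ultimately show ?thesis
    using card_pairs_containing[OF assms] by (simp add: card_pairs finite_level)
qed

section \<open>Degrees and sizes of levels\<close>

lemma diam_pos: "diam \<ge> 1"
proof (rule ccontr)
  assume "\<not> diam \<ge> 1"
  then have "card V - 1 = 0" using V_nonempty sum_card_level by fastforce
  then show False using card_V by simp
qed

lemma neighbour_exists:
  assumes "w \<in> V"
  obtains a where "a \<in> level w 1"
proof -
  have "V \<noteq> {w}" using card_V by auto
  then obtain x where "x \<in> V" "x \<noteq> w" using assms by blast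
  then have "d x w \<noteq> 0" using assms d_eq_0 by blast
  then obtain k where "d x w = Suc k" using not0_implies_Suc by blast
  then obtain a where "a \<in> V" "d a w = 1" using d_step[of x w k] \<open>x \<in> V\<close> assms by blast
  then show ?thesis using that[of a] d_sym[of w a] assms by (auto simp: level_def)
qed

text \<open>Shortest paths reach a leaf \<open>w\<close> through its neighbour \<open>u\<close>, so
  every vertex except \<open>w\<close> is closer to \<open>u\<close> than to \<open>w\<close>, and
  \<open>equidistant {u, w}\<close> would be empty.\<close>

lemma no_leaf:
  assumes "w \<in> V"
  shows "card (level w 1) \<noteq> 1"
proof
  assume "card (level w 1) = 1"
  then obtain u where u: "level w 1 = {u}" by (auto simp: card_1_singleton_iff)
  then have uV: "u \<in> V" "d w u = 1" by (auto simp: level_def)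
  then have "u \<noteq> w" using assms d_eq_0[of w u] by auto
  have "x \<notin> equidistant {u, w}" if x: "x \<in> V" for x
  proof (cases "d x w")
    case 0
    then have "x = w" using d_eq_0 x assms by blast
    then show ?thesis using uV 0 by (auto simp: equidistant_def)
  next
    case (Suc m)
    then obtain y where y: "y \<in> V" "d x y = m" "d y w = 1" using d_step x assms by blast
    then have "y \<in> level w 1" using d_sym[of y w] assms by (simp add: level_def)
    then have "y = u" using u by simp
    then show ?thesis using y Suc by (auto simp: equidistant_def)
  qed
  then have "equidistant {u, w} = {}" using equidistant_subset by blast
  moreover have "{u, w} \<in> pairs V" using uV assms \<open>u \<noteq> w\<close> by (auto intro: pairsI)
  ultimately show False using card_equidistant by fastforce
qed

text \<open>Deleting one member of a coincident pair from five vertices leaves four, hence a second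
  pair equidistant from both \<open>w\<close> and \<open>a\<close>.\<close>

lemma card_level_le_4:
  assumes "w \<in> V"
  shows "card (level w i) \<le> 4"
proof (rule ccontr)
  assume c: "\<not> card (level w i) \<le> 4"
  obtain a where a: "a \<in> level w 1" using neighbour_exists[OF assms] .
  obtain p where p: "p \<in> pairs (level w i)" "{w, a} \<subseteq> equidistant p"
    using level_pair[OF assms a subset_refl, of i] c by auto
  obtain x y where xy: "p = {x, y}" "x \<in> level w i" using p(1) by (auto elim!: pairsE)
  have "card (level w i - {x}) \<ge> 4" using c xy(2) finite_level[of w i] by simp
  then obtain q where q: "q \<in> pairs (level w i - {x})" "{w, a} \<subseteq> equidistant q"
    using level_pair[OF assms a, of "level w i - {x}" i] by auto
  have "w \<noteq> a" using neq_of_level_1 a assms by blast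
  then have "p = q"
    using p q pairs_mono[of "level w i - {x}" V] pairs_mono[of "level w i" V] level_subset[of w i]
    by (intro pair_unique[of p q w a]) auto
  then show False using xy q(1) by (auto simp: pairs_def)
qed

text \<open>Each level of size 4 yields a pair equidistant from \<open>w\<close> and a fixed
  neighbour \<open>a\<close>; there is only one such pair, and it lies in one level.\<close>

lemma level_4_unique:
  assumes "w \<in> V" "card (level w i) = 4" "card (level w j) = 4"
  shows "i = j"
proof -
  obtain a where a: "a \<in> level w 1" using neighbour_exists[OF assms(1)] .
  obtain p where p: "p \<in> pairs (level w i)" "{w, a} \<subseteq> equidistant p"
    using level_pair[OF assms(1) a subset_refl, of i] assms(2) by auto
  obtain q where q: "q \<in> pairs (level w j)" "{w, a} \<subseteq> equidistant q"
    using level_pair[OF assms(1) a subset_refl, of j] assms(3) by auto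
  have "w \<noteq> a" using neq_of_level_1 a assms by blast
  then have "p = q"
    using p q pairs_mono[of "level w i" V] pairs_mono[of "level w j" V] level_subset
    by (intro pair_unique[of p q w a]) auto
  then show ?thesis using p(1) q(1) by (auto elim!: pairsE simp: level_def doubleton_eq_iff)
qed

text \<open>Every vertex other than \<open>w\<close> is equidistant from one of the six pairs of
  neighbours, and each pair serves only one such vertex, since \<open>w\<close> is the other one.
  Hence \<open>card V - 1\<close> is at most 6.\<close>

lemma degree_neq_4:
  assumes w: "w \<in> V"
  shows "card (level w 1) \<noteq> 4"
proof
  assume N: "card (level w 1) = 4"
  obtain p where p: "\<And>x. x \<in> V \<Longrightarrow> p x \<in> pairs (level w 1)" "\<And>x. x \<in> V \<Longrightarrow> x \<in> equidistant (p x)"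
    using equidistant_from_neighbours[OF w N] by metis
  have "inj_on p (V - {w})"
  proof (rule inj_onI, rule ccontr)
    fix x y assume xy: "x \<in> V - {w}" "y \<in> V - {w}" "p x = p y" "x \<noteq> y"
    then have "{w, x, y} \<subseteq> equidistant (p x)"
      using p(2)[of x] p(2)[of y] pairs_level_equidistant(2)[OF w p(1)[of x]] by auto
    then have "card {w, x, y} \<le> card (equidistant (p x))"
      using finite_equidistant card_mono by blast
    moreover have "card {w, x, y} = 3" using xy by auto
    moreover have "card (equidistant (p x)) = 2"
      using card_equidistant pairs_level_equidistant(1)[OF w p(1)] xy by auto
    ultimately show False by simp
  qed
  then have "card (V - {w}) \<le> card (pairs (level w 1))"
    using p(1) finite_pairs[OF finite_level] by (intro card_inj_on_le[of p]) auto
  then have "card V - 1 \<le> 6"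
    using w finite_V N by (simp add: card_pairs finite_level numeral_eq_Suc)
  moreover have C: "(\<Sum>i=1..diam. card (level w i) choose 2) = 6 + (\<Sum>i=2..diam. card (level w i) choose 2)"
    using diam_pos N by (simp add: sum.atLeast_Suc_atMost numeral_eq_Suc)
  moreover have S: "(\<Sum>i=1..diam. card (level w i)) = 4 + (\<Sum>i=2..diam. card (level w i))"
    using diam_pos N by (simp add: sum.atLeast_Suc_atMost numeral_eq_Suc)
  \<comment> \<open>Level 1 alone contributes 6 to the binomial sum, which is at most 6; so the
    other levels contribute nothing, and the sizes add up to 6 = 4 + 2.\<close>
  ultimately have C0: "(\<Sum>i=2..diam. card (level w i) choose 2) = 0"
    and S2: "(\<Sum>i=2..diam. card (level w i)) = 2"
    using sum_card_level[OF w] sum_level_choose_2[OF w] by linarith+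
  have le1: "card (level w i) \<le> 1" if "i \<ge> 2" for i
  proof (cases "i \<le> diam")
    case True
    then have "card (level w i) choose 2 = 0" using C0 that by simp
    then show ?thesis by (simp add: binomial_eq_0_iff)
  next
    case False
    then have "level w i = {}" using d_le_diam[OF w] by (auto simp: level_def)
    then show ?thesis by simp
  qed
  define m where "m = Max (d w ` V)"
  have le_m: "d w x \<le> m" if "x \<in> V" for x
    unfolding m_def using that finite_V by (intro Max_ge) auto
  have "m \<in> d w ` V" unfolding m_def using finite_V V_nonempty by (intro Max_in) auto
  then obtain x where x: "x \<in> V" "d w x = m" by blast
  \<comment> \<open>A single level of size at most 1 cannot hold the two remaining vertices.\<close>
  have "m \<ge> 3"
  proof (rule ccontr)
    assume "\<not> m \<ge> 3"
    then have "level w i = {}" if "i \<ge> 3" for i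
      using le_m that by (fastforce simp: level_def)
    then have "(\<Sum>i=2..diam. card (level w i)) \<le> (\<Sum>i=2..diam. if i = 2 then 1 else 0)"
      using le1 by (intro sum_mono) auto
    also have "\<dots> \<le> 1" by simp
    finally show False using S2 by simp
  qed
  \<comment> \<open>Level \<open>m\<close> is just \<open>x\<close> and nothing lies beyond it.
    Level \<open>m - 1\<close> has at most one vertex because \<open>m - 1\<close> is at least 2, so
    \<open>x\<close> is a leaf.\<close>
  have "level x 1 \<subseteq> level w (m - 1)"
  proof
    fix y assume y: "y \<in> level x 1"
    then have yV: "y \<in> V" "d x y = 1" by (auto simp: level_def)
    then have "x \<noteq> y" using d_eq_0[of x y] by auto
    have "y \<notin> level w m"
      using le1[of m] \<open>m \<ge> 3\<close> x \<open>x \<noteq> y\<close> finite_level[of w m] card_le_Suc0_iff_eq[of "level w m"]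
      by (auto simp: level_def)
    then have "d w y \<noteq> m" "d w y \<le> m" using yV le_m by (auto simp: level_def)
    moreover have "d w y \<in> {m - 1, m, m + 1}"
      using d_neighbour_cases[OF x(1) yV(1) w yV(2)] x(2) by simp
    ultimately show "y \<in> level w (m - 1)" using yV by (auto simp: level_def)
  qed
  then have "card (level x 1) \<le> 1"
    using le1[of "m - 1"] \<open>m \<ge> 3\<close> card_mono[OF finite_level, of "level x 1" w "m - 1"] by linarith
  moreover have "level x 1 \<noteq> {}" using neighbour_exists[OF x(1)] by blast
  then have "card (level x 1) \<noteq> 0" using finite_level by simp
  ultimately show False using no_leaf[OF x(1)] by linarith
qed

lemma degree_2_or_3:
  assumes "w \<in> V"
  shows "card (level w 1) \<in> {2, 3}"
proof -
  have "level w 1 \<noteq> {}" using neighbour_exists[OF assms] by blast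
  then have "card (level w 1) \<noteq> 0" using finite_level by simp
  moreover have "card (level w 1) \<noteq> 1" "card (level w 1) \<noteq> 4" "card (level w 1) \<le> 4"
    using no_leaf degree_neq_4 card_level_le_4 assms by auto
  ultimately show ?thesis by auto
qed

text \<open>Without a level of size 4 the binomial sum is termwise at most the sum of the sizes;
  both are \<open>card V - 1\<close>, so equality holds in each term.\<close>

lemma levels_0_or_3:
  assumes w: "w \<in> V" and no4: "\<And>i. card (level w i) \<noteq> 4" and i: "i \<in> {1..diam}"
  shows "card (level w i) \<in> {0, 3}"
proof (rule ccontr)
  assume n: "card (level w i) \<notin> {0, 3}"
  have le: "card (level w j) \<le> 3" for j
    using no4[of j] card_level_le_4[OF w, of j] by linarith
  have "(\<Sum>i=1..diam. card (level w i) choose 2) < (\<Sum>i=1..diam. card (level w i))"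
  proof (rule sum_strict_mono_ex1)
    show "\<forall>j\<in>{1..diam}. card (level w j) choose 2 \<le> card (level w j)"
      using le choose_2_le by blast
    show "\<exists>j\<in>{1..diam}. card (level w j) choose 2 < card (level w j)"
      using choose_2_less[OF le n] n i by (intro bexI[of _ i]) auto
  qed simp
  then show False using sum_card_level[OF w] sum_level_choose_2[OF w] by simp
qed

text \<open>Some neighbour \<open>x\<close> of \<open>w\<close> is equidistant from a pair of
  neighbours of \<open>w\<close>. That pair is the only one for \<open>w\<close> and
  \<open>x\<close>, whereas a level of size 4 would supply one of its own.\<close>

lemma degree_3_no_level_4:
  assumes w: "w \<in> V" and N: "card (level w 1) = 3"
  shows "card (level w i) \<noteq> 4"
proof
  assume i: "card (level w i) = 4"
  obtain x p where p: "p \<in> pairs (level w 1)" and x: "x \<in> level w 1" "x \<in> equidistant p"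
    using triple_equidistant[OF w N] .
  obtain q where q: "q \<in> pairs (level w i)" "{w, x} \<subseteq> equidistant q"
    using level_pair[OF w x(1) subset_refl, of i] i by auto
  have "p = q"
    using pairs_level_equidistant[OF w p] pairs_level_equidistant[OF w q(1)] q(2) x(2)
      neq_of_level_1[OF w x(1)] by (intro pair_unique[of p q w x]) auto
  then have "i = 1" using p q(1) by (auto elim!: pairsE simp: level_def doubleton_eq_iff)
  then show False using i N by simp
qed

lemma degree_3_levels:
  assumes "w \<in> V" "card (level w 1) = 3" "i \<in> {1..diam}"
  shows "card (level w i) \<in> {0, 3}"
  using levels_0_or_3[OF assms(1) degree_3_no_level_4 assms(3)] assms by blast

lemma degree_3_card_V:
  assumes "w \<in> V" "card (level w 1) = 3"
  shows "3 dvd card V - 1"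
proof -
  have "3 dvd (\<Sum>i=1..diam. card (level w i))"
    using degree_3_levels[OF assms] by (intro dvd_sum) fastforce
  then show ?thesis using sum_card_level[OF assms(1)] by simp
qed

text \<open>Level 1 and the level of size 4 have 6 vertices but 7 pairs, so the other levels have
  total deficit 1. Exactly one of them has size 1 or 2, and the rest have size 0 or 3, contrary to
  \<open>dvd\<close>.\<close>

lemma degree_neq_2:
  assumes dvd: "3 dvd card V - 1" and w: "w \<in> V"
  shows "card (level w 1) \<noteq> 2"
proof
  let ?s = "\<lambda>i. card (level w i)"
  assume N: "?s 1 = 2"
  \<comment> \<open>Otherwise every level, level 1 included, would have size 0 or 3.\<close>
  have "\<exists>k. ?s k = 4"
    using levels_0_or_3[OF w, of 1] N diam_pos by force
  then obtain k where k: "?s k = 4" by blast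
  then obtain x where "x \<in> level w k" by fastforce
  then have "k \<le> diam" using d_le_diam[OF w, of x] by (simp add: level_def)
  moreover have "k \<noteq> 0" using k level_0[OF w] by (cases k) auto
  ultimately have "k \<in> {1..diam}" by simp
  have "k \<noteq> 1" using N k by auto
  define I where "I = {1..diam} - {1} - {k}"
  then have "finite I" by simp
  have split: "(\<Sum>i=1..diam. f i) = f 1 + f k + sum f I" for f :: "nat \<Rightarrow> nat"
    using sum.remove[of "{1..diam}" 1 f] sum.remove[of "{1..diam} - {1}" k f]
      diam_pos \<open>k \<noteq> 1\<close> \<open>k \<in> {1..diam}\<close> unfolding I_def by auto
  have le: "?s i \<le> 3" if "i \<in> I" for i
    using card_level_le_4[OF w, of i] level_4_unique[OF w, of i k] k that
    by (cases "?s i = 4") (auto simp: I_def)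
  \<comment> \<open>The deficit of level \<open>i\<close>. The subtraction does not truncate on
    \<open>I\<close>, where sizes are at most 3.\<close>
  define t where "t i = ?s i - (?s i choose 2)" for i
  have "sum ?s I = sum t I + (\<Sum>i\<in>I. ?s i choose 2)"
    unfolding sum.distrib[symmetric] t_def using le choose_2_le by (intro sum.cong) auto
  moreover have "6 + 1 + (\<Sum>i\<in>I. ?s i choose 2) = card V - 1"
    using sum_level_choose_2[OF w] split[of "\<lambda>i. ?s i choose 2"] N k by (simp add: numeral_eq_Suc)
  moreover have S: "6 + sum ?s I = card V - 1"
    using sum_card_level[OF w] split[of ?s] N k by simp
  ultimately have "sum t I = 1" by linarith
  then obtain j where j: "j \<in> I" "t j = 1" "\<forall>i\<in>I. j \<noteq> i \<longrightarrow> t i = 0"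
    using sum_eq_1_iff[of I t] \<open>finite I\<close> by auto
  have "?s i \<in> {0, 3}" if "i \<in> I - {j}" for i
    using choose_2_less[OF le[of i]] j(3) that by (fastforce simp: t_def)
  then have "3 dvd sum ?s (I - {j})" by (intro dvd_sum) fastforce
  moreover have "sum ?s I = ?s j + sum ?s (I - {j})"
    using j(1) by (intro sum.remove) (auto simp: I_def)
  \<comment> \<open>All other terms of \<open>S\<close> are divisible by 3. But sizes 0 and 3 have
    deficit 0, not 1.\<close>
  ultimately have "3 dvd ?s j" using S dvd by presburger
  then have "?s j = 0 \<or> ?s j = 3" using le[OF j(1)] by (auto simp: dvd_def)
  then show False using j(2) by (auto simp: t_def numeral_eq_Suc)
qed

text \<open>If all degrees are 2, a vertex other than \<open>w\<close> has a neighbour closer to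
  \<open>w\<close> and so at most one farther away. Hence levels do not grow from level 1 on, and
  \<open>levels_0_or_3\<close> applies.\<close>

lemma degree_3_exists: "\<exists>w\<in>V. card (level w 1) = 3"
proof (rule ccontr)
  assume "\<not> ?thesis"
  then have deg: "card (level w 1) = 2" if "w \<in> V" for w using degree_2_or_3 that by blast
  obtain w where w: "w \<in> V" using V_nonempty by blast
  have "card (level w (Suc i)) \<le> 2" for i
  proof (induction i)
    case 0
    then show ?case using deg[OF w] by simp
  next
    case (Suc i)
    have "\<forall>x\<in>level w (Suc (Suc i)). \<exists>y. y \<in> level w (Suc i) \<and> d y x = 1"
      using d_step[OF w] by (fastforce simp: level_def)
    then obtain g where g: "\<And>x. x \<in> level w (Suc (Suc i)) \<Longrightarrow> g x \<in> level w (Suc i) \<and> d (g x) x = 1"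
      by metis
    have "inj_on g (level w (Suc (Suc i)))"
    proof (rule inj_onI, rule ccontr)
      fix x x' assume x: "x \<in> level w (Suc (Suc i))" "x' \<in> level w (Suc (Suc i))" "g x = g x'" "x \<noteq> x'"
      define y where "y = g x"
      have y: "y \<in> V" "d w y = Suc i" "d y x = 1" "d y x' = 1"
        using g[OF x(1)] g[OF x(2)] x(3) by (auto simp: y_def level_def)
      then obtain z where z: "z \<in> V" "d w z = i" "d z y = 1" using d_step[OF w] by blast
      \<comment> \<open>The vertex \<open>z\<close> lies in an earlier level than \<open>x\<close>
        and \<open>x'\<close>, so it is a third neighbour of \<open>y\<close>.\<close>
      have "{x, x', z} \<subseteq> level y 1" using x y z d_sym[of z y] by (auto simp: level_def)
      then have "card {x, x', z} \<le> 2" using card_mono[OF finite_level] deg[OF y(1)] by metis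
      moreover have "z \<noteq> x" "z \<noteq> x'" using x z by (auto simp: level_def)
      ultimately show False using x(4) by auto
    qed
    then have "card (level w (Suc (Suc i))) \<le> card (level w (Suc i))"
      using g finite_level by (intro card_inj_on_le[of g]) auto
    then show ?case using Suc by linarith
  qed
  moreover have "card (level w 0) \<le> 2" using level_0[OF w] by simp
  ultimately have le_2: "card (level w i) \<le> 2" for i by (cases i) auto
  have "card (level w i) \<noteq> 4" for i using le_2[of i] by linarith
  then have "card (level w 1) \<in> {0, 3}" using levels_0_or_3[OF w] diam_pos by auto
  then show False using deg[OF w] by simp
qed

lemma degree_3: "w \<in> V \<Longrightarrow> card (level w 1) = 3"
  using degree_3_exists degree_3_card_V degree_neq_2 degree_2_or_3 by blast

section \<open>The diameter of the cubic graph\<close>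

lemma diam_1: "diam = 1"
proof (rule ccontr)
  assume "diam \<noteq> 1"
  then have D: "diam \<ge> 2" using diam_pos by simp
  obtain w v where wv: "w \<in> V" "v \<in> V" "d w v = diam" using diam_attained by blast
  note N = degree_3[OF wv(1)]
  \<comment> \<open>Each of the three pairs contributes one vertex, since \<open>w\<close> takes up
    the other place in its equidistant set.\<close>
  define X where "X = (\<Union>p\<in>pairs (level w 1). equidistant p - {w})"
  have "card X \<le> (\<Sum>p\<in>pairs (level w 1). card (equidistant p - {w}))"
    unfolding X_def by (intro card_UN_le finite_pairs finite_level)
  also have "\<dots> = (\<Sum>p\<in>pairs (level w 1). 1)"
    using pairs_level_equidistant[OF wv(1)] card_equidistant finite_equidistant by (intro sum.cong) auto
  also have "\<dots> = 3" using N by (simp add: card_pairs finite_level numeral_eq_Suc)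
  finally have "card X \<le> 3" .
  moreover have "level w diam \<subseteq> X"
  proof
    fix x assume "x \<in> level w diam"
    then have x: "x \<in> V" "d x w = diam" "x \<noteq> w"
      using wv(1) d_sym[of w x] D d_eq_0[OF wv(1) wv(1)] by (auto simp: level_def)
    \<comment> \<open>Distance \<open>diam + 1\<close> does not occur, so three neighbours share two
      values.\<close>
    have "\<exists>p\<in>pairs (level w 1). \<forall>y\<in>p. \<forall>z\<in>p. d x y = d x z"
    proof (rule pigeonhole_pair)
      show "d x ` level w 1 \<subseteq> {diam - 1, diam}"
      proof
        fix k assume "k \<in> d x ` level w 1"
        then obtain a where a: "a \<in> V" "d w a = 1" "k = d x a" by (auto simp: level_def)
        then show "k \<in> {diam - 1, diam}"
          using d_neighbour_cases[OF wv(1) a(1) x(1) a(2)] d_le_diam[OF x(1) a(1)] x(2) by auto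
      qed
      show "card {diam - 1, diam} < card (level w 1)" using N by (simp add: card_insert_if)
    qed simp
    then show "x \<in> X" unfolding X_def equidistant_def using x by blast
  qed
  \<comment> \<open>The neighbour \<open>c\<close> takes one of the three places in \<open>X\<close>
    and is not in the last level. This leaves two places for that level, whose size would have to be
    3.\<close>
  moreover obtain c p where c: "p \<in> pairs (level w 1)" "c \<in> level w 1" "c \<in> equidistant p"
    using triple_equidistant[OF wv(1) N] .
  then have "c \<in> X" using neq_of_level_1[OF wv(1)] unfolding X_def by blast
  moreover have "c \<notin> level w diam" using c(2) D by (auto simp: level_def)
  moreover have "finite X"
    unfolding X_def using finite_pairs[OF finite_level] finite_equidistant by (intro finite_UN_I) auto
  ultimately have "card (insert c (level w diam)) \<le> 3"
    using card_mono[of X "insert c (level w diam)"] by auto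
  then have "card (level w diam) \<le> 2" using \<open>c \<notin> level w diam\<close> finite_level by simp
  moreover have "level w diam \<noteq> {}" using wv by (auto simp: level_def)
  then have "card (level w diam) \<noteq> 0" using finite_level by simp
  ultimately show False using degree_3_levels[OF wv(1) N, of diam] diam_pos by auto
qed

theorem complete_4:
  shows "card V = 4" and "\<And>u v. u \<in> V \<Longrightarrow> v \<in> V \<Longrightarrow> u \<noteq> v \<Longrightarrow> d u v = 1"
proof -
  obtain w where "w \<in> V" using V_nonempty by blast
  then have "card V - 1 = 3" using sum_card_level[of w] degree_3[of w] diam_1 by simp
  then show "card V = 4" by simp
  show "d u v = 1" if "u \<in> V" "v \<in> V" "u \<noteq> v" for u v
    using d_le_diam[of u v] d_eq_0[of u v] diam_1 that by linarith
qed

end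

section \<open>Walk distances in graphs and the reduction to
  \<open>randomly_3_dimensional\<close>\<close>

lemma resolving_set_iff:
  assumes "finite W"
  shows "resolving_set G W \<longleftrightarrow> W \<subseteq> verts G \<and>
    (\<forall>u\<in>verts G. \<forall>v\<in>verts G. (\<forall>w\<in>W. gdist G u w = gdist G v w) \<longrightarrow> u = v)"
proof -
  obtain ws where ws: "distinct ws" "set ws = W" using finite_distinct_list[OF assms] by blast
  show ?thesis
    unfolding resolving_set_any_order[OF ws] inj_on_def metric_rep_def using ws(2) by auto
qed

context graph
begin

text \<open>A natural number in place of the \<open>ereal\<close> infimum \<open>gdist\<close>. It
  is meaningful only if some walk exists, as connectedness guarantees for vertices.\<close>

definition hop_distance :: "'a \<Rightarrow> 'a \<Rightarrow> nat" where
  "hop_distance u v = (LEAST n. \<exists>p. awalk u p v \<and> length p = n)"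

lemma hop_distance_le: "awalk u p v \<Longrightarrow> hop_distance u v \<le> length p"
  unfolding hop_distance_def by (rule Least_le) blast

lemma awalk_reverse:
  assumes "awalk u p v"
  shows "\<exists>q. awalk v q u \<and> length q = length p"
  using assms
proof (induction p arbitrary: u)
  case Nil
  then show ?case by (intro exI[of _ "[]"]) (auto simp: awalk_Nil_iff)
next
  case (Cons e es)
  then have e: "e \<in> arcs G" "u = tail G e" "awalk (head G e) es v" by (auto simp: awalk_Cons_iff)
  then obtain q where q: "awalk v q (head G e)" "length q = length es" using Cons.IH by blast
  obtain e' where e': "e' \<in> arcs G" "tail G e = head G e'" "head G e = tail G e'"
    using sym_arcs e(1) unfolding symmetric_conv by blast
  then have "awalk (head G e) [e'] u" using e by (simp add: awalk_Cons_iff awalk_Nil_iff)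
  then have "awalk v (q @ [e']) u" using q(1) awalk_appendI by blast
  then show ?case using q(2) by (intro exI[of _ "q @ [e']"]) simp
qed

lemma awalk_cost_1: "awalk_cost (\<lambda>_. 1) p = real (length p)"
  by (induction p) auto

context
  assumes conn: "Digraph_Component.connected G"
begin

lemma shortest_awalk:
  assumes "u \<in> verts G" "v \<in> verts G"
  obtains p where "awalk u p v" "length p = hop_distance u v"
proof -
  have "strongly_connected G" using symmetric_connected_imp_strongly_connected sym_arcs conn by blast
  then have "u \<rightarrow>\<^sup>* v" using assms unfolding strongly_connected_def by blast
  then have "\<exists>n p. awalk u p v \<and> length p = n" unfolding reachable_awalk by blast
  then have "\<exists>p. awalk u p v \<and> length p = hop_distance u v"
    unfolding hop_distance_def by (rule LeastI_ex)
  then show ?thesis using that by blast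
qed

text \<open>With unit costs the infimum over walks is attained by a shortest walk.\<close>

lemma gdist_eq_hop_distance:
  assumes "u \<in> verts G" "v \<in> verts G"
  shows "gdist G u v = ereal (real (hop_distance u v))"
proof (rule antisym)
  obtain p where "awalk u p v" "length p = hop_distance u v" using shortest_awalk[OF assms] .
  then show "gdist G u v \<le> ereal (real (hop_distance u v))"
    unfolding gdist_def \<mu>_def by (intro INF_lower2[of p]) (auto simp: awalk_cost_1)
  show "ereal (real (hop_distance u v)) \<le> gdist G u v"
    unfolding gdist_def \<mu>_def by (intro INF_greatest) (auto simp: awalk_cost_1 hop_distance_le)
qed

lemma hop_distance_triangle:
  assumes "u \<in> verts G" "v \<in> verts G" "w \<in> verts G"
  shows "hop_distance u w \<le> hop_distance u v + hop_distance v w"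
proof -
  obtain p where p: "awalk u p v" "length p = hop_distance u v" using shortest_awalk assms by blast
  obtain q where q: "awalk v q w" "length q = hop_distance v w" using shortest_awalk assms by blast
  show ?thesis using hop_distance_le[OF awalk_appendI[OF p(1) q(1)]] p(2) q(2) by simp
qed

lemma hop_distance_sym_le:
  assumes "u \<in> verts G" "v \<in> verts G"
  shows "hop_distance v u \<le> hop_distance u v"
proof -
  obtain p where p: "awalk u p v" "length p = hop_distance u v" using shortest_awalk[OF assms] .
  obtain q where "awalk v q u" "length q = length p" using awalk_reverse[OF p(1)] by blast
  then show ?thesis using hop_distance_le[of v q u] p(2) by simp
qed

lemma hop_distance_eq_0:
  assumes "u \<in> verts G" "v \<in> verts G"
  shows "hop_distance u v = 0 \<longleftrightarrow> u = v"
proof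
  assume 0: "hop_distance u v = 0"
  obtain p where "awalk u p v" "length p = hop_distance u v" using shortest_awalk[OF assms] .
  then have "awalk u [] v" using 0 by simp
  then show "u = v" by (simp add: awalk_Nil_iff)
next
  assume "u = v"
  then have "awalk u [] v" using assms by (simp add: awalk_Nil_iff)
  then show "hop_distance u v = 0" using hop_distance_le[of u "[]" v] by simp
qed

lemma hop_distance_step:
  assumes "u \<in> verts G" "v \<in> verts G" "hop_distance u v = Suc m"
  shows "\<exists>x\<in>verts G. hop_distance u x = m \<and> hop_distance x v = 1"
proof -
  obtain p where p: "awalk u p v" "length p = Suc m"
    using shortest_awalk[OF assms(1,2)] assms(3) by auto
  then obtain q e where qe: "p = q @ [e]" by (metis length_0_conv nat.distinct(1) rev_exhaust)
  \<comment> \<open>The predecessor of \<open>v\<close> on a shortest walk; the triangle inequality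
    turns the two bounds below into equalities.\<close>
  define x where "x = tail G e"
  have x: "awalk u q x" "awalk x [e] v" using p(1) by (auto simp: qe x_def awalk_Cons_iff)
  then have "x \<in> verts G" by auto
  moreover have "hop_distance u x \<le> m" "hop_distance x v \<le> 1"
    using hop_distance_le[OF x(1)] hop_distance_le[OF x(2)] p(2) qe by auto
  ultimately show ?thesis
    using hop_distance_triangle[OF assms(1) _ assms(2), of x] assms(3) by (intro bexI[of _ x]) auto
qed

lemma graph_metric_hop_distance: "graph_metric (verts G) hop_distance"
proof
  show "verts G \<noteq> {}"
    using conn by (simp add: Digraph_Component.connected_def strongly_connected_def)
qed (use hop_distance_eq_0 hop_distance_triangle hop_distance_step hop_distance_sym_le
      in \<open>auto intro: antisym\<close>)

lemma resolving_set_hop_distance: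
  assumes "W \<subseteq> verts G"
  shows "resolving_set G W \<longleftrightarrow>
    (\<forall>u\<in>verts G. \<forall>v\<in>verts G. (\<forall>w\<in>W. hop_distance u w = hop_distance v w) \<longrightarrow> u = v)"
proof -
  have "finite W" using assms finite_verts finite_subset by blast
  have "(\<forall>w\<in>W. gdist G u w = gdist G v w) \<longleftrightarrow> (\<forall>w\<in>W. hop_distance u w = hop_distance v w)"
    if "u \<in> verts G" "v \<in> verts G" for u v
  proof (intro ball_cong refl)
    fix w assume "w \<in> W"
    then have "w \<in> verts G" using assms by blast
    then show "(gdist G u w = gdist G v w) \<longleftrightarrow> (hop_distance u w = hop_distance v w)"
      using that by (simp add: gdist_eq_hop_distance)
  qed
  then show ?thesis using assms unfolding resolving_set_iff[OF \<open>finite W\<close>] by blast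
qed

lemma randomly_3_dimensional_hop_distance:
  assumes "randomly_dimensional 3 G"
  shows "randomly_3_dimensional (verts G) hop_distance"
proof -
  interpret graph_metric "verts G" hop_distance by (rule graph_metric_hop_distance)
  \<comment> \<open>Finiteness makes the \<open>Min\<close> in \<open>metric_dimension\<close> a
    genuine lower bound.\<close>
  have "{W. resolving_set G W} \<subseteq> Pow (verts G)" unfolding resolving_set_def by blast
  then have fin: "finite (card ` {W. resolving_set G W})"
    using finite_verts by (meson finite_Pow_iff finite_imageI finite_subset)
  have min: "3 \<le> card W" if "resolving_set G W" for W
  proof -
    have "Min (card ` {W. resolving_set G W}) = 3"
      using assms by (simp add: randomly_dimensional_def metric_dimension_def)
    then show ?thesis using Min_le[OF fin, of "card W"] that by auto
  qed
  have resolving: "resolving_set G W" if "W \<subseteq> verts G" "card W = 3" for W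
    using assms that by (auto simp: randomly_dimensional_def metric_basis_def is_arg_min_def)
  show ?thesis
  proof
    \<comment> \<open>Only \<open>u\<close> is at distance 0 from \<open>u\<close>, so the whole
      vertex set resolves and has at least 3 elements.\<close>
    have "u = v"
      if "u \<in> verts G" "v \<in> verts G" "\<forall>w\<in>verts G. hop_distance u w = hop_distance v w" for u v
      using bspec[OF that(3,1)] d_eq_0[OF that(1,1)] d_eq_0[OF that(2,1)] by metis
    then have "resolving_set G (verts G)"
      unfolding resolving_set_hop_distance[OF subset_refl] by blast
    then show "card (verts G) \<ge> 2" using min by fastforce
  next
    fix u v assume uv: "u \<in> verts G" "v \<in> verts G" "u \<noteq> v"
    show "card (equidistant {u, v}) \<le> 2"
    proof (rule ccontr)
      assume "\<not> ?thesis"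
      \<comment> \<open>Three vertices equidistant from \<open>u\<close> and \<open>v\<close> form a
        triple that does not resolve.\<close>
      then obtain W where W: "W \<subseteq> equidistant {u, v}" "card W = 3"
        using obtain_subset_with_card_n[of 3 "equidistant {u, v}"] by auto
      then have "W \<subseteq> verts G" "\<forall>w\<in>W. hop_distance w u = hop_distance w v"
        by (auto simp: equidistant_def)
      moreover have "\<forall>w\<in>W. hop_distance u w = hop_distance v w"
        using calculation uv d_sym by (metis subsetD)
      ultimately show False
        using resolving[OF _ W(2)] uv resolving_set_hop_distance[of W] by blast
    qed
  next
    fix w x assume wx: "w \<in> verts G" "x \<in> verts G" "w \<noteq> x"
    then have "\<not> resolving_set G {w, x}" using min[of "{w, x}"] by auto
    then obtain u v where uv: "u \<in> verts G" "v \<in> verts G" "u \<noteq> v"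
      "\<forall>y\<in>{w, x}. hop_distance u y = hop_distance v y"
      using wx resolving_set_hop_distance[of "{w, x}"] by auto
    then have "\<forall>y\<in>{w, x}. hop_distance y u = hop_distance y v"
      using wx d_sym by (metis insertE singletonD)
    then show "\<exists>p\<in>pairs (verts G). {w, x} \<subseteq> equidistant p"
      using uv wx by (intro bexI[of _ "{u, v}"]) (auto simp: equidistant_def intro: pairsI)
  qed
qed

lemma adjacent_if_hop_distance_1:
  assumes "u \<in> verts G" "v \<in> verts G" "hop_distance u v = 1"
  shows "(u, v) \<in> arcs_ends G"
proof -
  obtain p where p: "awalk u p v" "length p = 1"
    using shortest_awalk[OF assms(1,2)] assms(3) by auto
  then obtain e where "p = [e]" by (auto simp: length_Suc_conv)
  then have "e \<in> arcs G" "tail G e = u" "head G e = v"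
    using p(1) by (auto simp: awalk_Cons_iff awalk_Nil_iff)
  then show ?thesis using in_arcs_imp_in_arcs_ends by blast
qed

end

end

theorem mainTheorem2:
  fixes G :: "('a, 'b) pre_digraph"
  assumes "graph G"
    and "Digraph_Component.connected G"
    and "randomly_dimensional 3 G"
  shows "complete_digraph 4 G"
proof -
  interpret graph G by fact
  interpret R: randomly_3_dimensional "verts G" hop_distance
    using randomly_3_dimensional_hop_distance assms by blast
  have "(u, v) \<in> arcs_ends G" if "u \<in> verts G" "v \<in> verts G" "u \<noteq> v" for u v
    using adjacent_if_hop_distance_1[OF assms(2)] R.complete_4(2) that by blast
  moreover have "u \<in> verts G \<and> v \<in> verts G \<and> u \<noteq> v" if "(u, v) \<in> arcs_ends G" for u v
    using that adj_not_same by auto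
  ultimately have "arcs_ends G = {(u, v). (u, v) \<in> verts G \<times> verts G \<and> u \<noteq> v}"
    by (intro set_eqI) blast
  then show ?thesis using R.complete_4(1) assms(1) by (simp add: complete_digraph_def)
qed

end
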